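(* Let $G=(V,E)$ be a finite connected graph with edge set $E=\{e_1,\dots,e_m\}$, and let $\mathbf{w}_0=(w_{0,e})_{e\in E}$ be an initial weight vector with $w_{0,e}>0$ for all $e\in E$. Consider the discrete quasi-normalized Ricci curvature flow with step size $s>0$, $$w_e^{(j+1)}=w_e^{(j)}+s\left(-\kappa_e^{(j)}+\frac{\sum_{\tau\in E}\kappa_\tau^{(j)}\rho_\tau^{(j)}}{\sum_{\tau\in E}w_\tau^{(j)}}\right)\rho_e^{(j)},\qquad w_e^{(j)}>0,\qquad w_e^{(0)}=w_{0,e},\qquad j\in\mathbb{N},\ e\in E. \quad ( * )$$ (i) If $\kappa$ is Ollivier's Ricci curvature, then for any $0<s<1/(m+1)$ the flow $( * )$ has a unique global solution $(w_e^{(j)})_{j\in\mathbb{N}}$, $e\in E$; moreover, $$(1-(m+1)s)^j w_{0,e}\le w_e^{(j)}\le (1+ms)^j\sum_{\tau\in E}w_{0,\tau},\qquad \forall j\in\mathbb{N},\ \forall e\in E.$$ (ii) If $\kappa$ is Lin-Lu-Yau's Ricci curvature, then for any $0<s<1/(2m+2)$ the flow $( * )$ has a unique global solution $(w_e^{(j)})_{j\in\mathbb{N}}$, $e\in E$; moreover, $$(1-2(m+1)s)^j w_{0,e}\le w_e^{(j)}\le (1+2(m+1)s)^j\sum_{\tau\in E}w_{0,\tau},\qquad \forall j\in\mathbb{N},\ \forall e\in E.$$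
   Context: Graphs are finite, undirected, simple and connected, with at least one edge; $\mathbb{N}$ includes $0$; $m=|E|$. For positive edge weights $\mathbf{w}=(w_e)_{e\in E}$ (write $w_{xy}=w_e$ for $e=xy$), the distance is $d(x,y)=\inf_\gamma\sum_{e\in\gamma}w_e$ over all paths $\gamma$ connecting $x$ and $y$. For an edge $e=xy$, $\rho_e=d(x,y)$ (so $\rho_e\le w_e$). For $\alpha\in[0,1]$ and $x\in V$, the $\alpha$-lazy one-step random walk is the probability measure with $\mu_x^\alpha(x)=\alpha$, $\mu_x^\alpha(z)=(1-\alpha)\,w_{xz}/\sum_{u\sim x}w_{xu}$ if $z\sim x$, and $\mu_x^\alpha(z)=0$ otherwise. For probability measures $\mu_1,\mu_2$ on $V$, the Wasserstein distance is $W(\mu_1,\mu_2)=\inf_A\sum_{u,v\in V}A(u,v)d(u,v)$ over all couplings $A:V\times V\to[0,1]$, i.e. $\sum_{x\in V}A(u,x)=\mu_1(u)$ and $\sum_{y\in V}A(y,v)=\mu_2(v)$ for all $u,v\in V$. Ollivier's Ricci curvature (for a fixed $\alpha$) on an edge $e=xy$ is $\kappa_e^\alpha=1-W(\mu_x^\alpha,\mu_y^\alpha)/\rho_e$; in statements about Ollivier's curvature, $\kappa_e=\kappa_e^\alpha$ for this fixed $\alpha$. Lin-Lu-Yau's Ricci curvature is $\kappa_e=\lim_{\alpha\to1^-}\kappa_e^\alpha/(1-\alpha)$. $\kappa_e^{(j)}$ and $\rho_e^{(j)}$ denote the curvature and the distance between the endpoints of $e$ computed from the weights $\mathbf{w}^{(j)}$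 (both the random walks and the distance use $\mathbf{w}^{(j)}$). A global solution is a sequence of vectors $\mathbf{w}^{(j)}$, $j\in\mathbb{N}$, with all entries positive, satisfying the recursion and the initial condition. *)

theory Defs
  imports Complex_Main "HOL-Library.FuncSet"
begin

text \<open>An edge is the two-element set of its endpoints, so a weight vector indexed by \<open>E\<close> is a
  function \<open>w :: 'a set \<Rightarrow> real\<close> of which only the values on \<open>E\<close> matter.\<close>

definition simple_graph :: "'a set \<Rightarrow> 'a set set \<Rightarrow> bool" where
  "simple_graph V E \<longleftrightarrow> finite V \<and> (\<forall>e\<in>E. \<exists>x\<in>V. \<exists>y\<in>V. x \<noteq> y \<and> e = {x, y})"

definition path_edges :: "'a list \<Rightarrow> 'a set list" where
  "path_edges xs = map (\<lambda>(u, v). {u, v}) (zip xs (tl xs))"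

text \<open>A path is its list of vertices; the one-vertex list is the path from a vertex to itself.\<close>

definition graph_path :: "'a set \<Rightarrow> 'a set set \<Rightarrow> 'a \<Rightarrow> 'a \<Rightarrow> 'a list \<Rightarrow> bool" where
  "graph_path V E x y xs \<longleftrightarrow>
     xs \<noteq> [] \<and> hd xs = x \<and> last xs = y \<and> distinct xs \<and> set xs \<subseteq> V \<and> set (path_edges xs) \<subseteq> E"

definition connected_graph :: "'a set \<Rightarrow> 'a set set \<Rightarrow> bool" where
  "connected_graph V E \<longleftrightarrow>
     simple_graph V E \<and> (\<forall>x\<in>V. \<forall>y\<in>V. \<exists>xs. graph_path V E x y xs)"

definition graph_dist :: "'a set \<Rightarrow> 'a set set \<Rightarrow> ('a set \<Rightarrow> real) \<Rightarrow> 'a \<Rightarrow> 'a \<Rightarrow> real" where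
  "graph_dist V E w x y = (INF xs \<in> {xs. graph_path V E x y xs}. sum_list (map w (path_edges xs)))"

definition lazy_walk ::
  "'a set \<Rightarrow> 'a set set \<Rightarrow> ('a set \<Rightarrow> real) \<Rightarrow> real \<Rightarrow> 'a \<Rightarrow> 'a \<Rightarrow> real" where
  "lazy_walk V E w \<alpha> x z =
     (if z = x then \<alpha>
      else if {x, z} \<in> E then (1 - \<alpha>) * w {x, z} / (\<Sum>u \<in> {u \<in> V. {x, u} \<in> E}. w {x, u})
      else 0)"

definition coupling ::
  "'a set \<Rightarrow> ('a \<Rightarrow> real) \<Rightarrow> ('a \<Rightarrow> real) \<Rightarrow> ('a \<Rightarrow> 'a \<Rightarrow> real) \<Rightarrow> bool" where
  "coupling V \<mu>1 \<mu>2 A \<longleftrightarrow>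
     (\<forall>u\<in>V. \<forall>v\<in>V. A u v \<in> {0..1}) \<and>
     (\<forall>u\<in>V. (\<Sum>x\<in>V. A u x) = \<mu>1 u) \<and>
     (\<forall>v\<in>V. (\<Sum>y\<in>V. A y v) = \<mu>2 v)"

definition wasserstein ::
  "'a set \<Rightarrow> ('a \<Rightarrow> 'a \<Rightarrow> real) \<Rightarrow> ('a \<Rightarrow> real) \<Rightarrow> ('a \<Rightarrow> real) \<Rightarrow> real" where
  "wasserstein V d \<mu>1 \<mu>2 =
     (INF A \<in> {A. coupling V \<mu>1 \<mu>2 A}. \<Sum>u\<in>V. \<Sum>v\<in>V. A u v * d u v)"

text \<open>Value at the edge \<open>e = {x, y}\<close> of a quantity \<open>f x y\<close> that is symmetric in the endpoints.
  Everything lifted below is symmetric (lemmas at the end).\<close>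

definition on_edge :: "('a \<Rightarrow> 'a \<Rightarrow> real) \<Rightarrow> 'a set \<Rightarrow> real" where
  "on_edge f e = (THE r. \<exists>x y. e = {x, y} \<and> r = f x y)"

definition edge_dist :: "'a set \<Rightarrow> 'a set set \<Rightarrow> ('a set \<Rightarrow> real) \<Rightarrow> 'a set \<Rightarrow> real" where
  "edge_dist V E w = on_edge (graph_dist V E w)"

definition ollivier_curvature ::
  "'a set \<Rightarrow> 'a set set \<Rightarrow> real \<Rightarrow> ('a set \<Rightarrow> real) \<Rightarrow> 'a set \<Rightarrow> real" where
  "ollivier_curvature V E \<alpha> w e =
     1 - on_edge (\<lambda>x y. wasserstein V (graph_dist V E w) (lazy_walk V E w \<alpha> x) (lazy_walk V E w \<alpha> y)) e
         / edge_dist V E w e"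

definition lin_lu_yau_curvature ::
  "'a set \<Rightarrow> 'a set set \<Rightarrow> ('a set \<Rightarrow> real) \<Rightarrow> 'a set \<Rightarrow> real" where
  "lin_lu_yau_curvature V E w e =
     Lim (at_left 1) (\<lambda>\<alpha>. ollivier_curvature V E \<alpha> w e / (1 - \<alpha>))"

text \<open>\<open>\<kappa> w e\<close> is the curvature of \<open>e\<close> computed from the weights \<open>w\<close>. Taking each \<open>w j\<close> in the
  extensional function space over \<open>E\<close> (fixed value off \<open>E\<close>) makes \<open>w j\<close> exactly a positive vector
  indexed by \<open>E\<close>, so that \<open>\<exists>!\<close> expresses uniqueness on \<open>E\<close>.\<close>

definition global_solution ::
  "'a set \<Rightarrow> 'a set set \<Rightarrow> (('a set \<Rightarrow> real) \<Rightarrow> 'a set \<Rightarrow> real) \<Rightarrow> real \<Rightarrow> ('a set \<Rightarrow> real)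
     \<Rightarrow> (nat \<Rightarrow> 'a set \<Rightarrow> real) \<Rightarrow> bool" where
  "global_solution V E \<kappa> s w0 w \<longleftrightarrow>
     (\<forall>j. w j \<in> E \<rightarrow>\<^sub>E {0<..}) \<and>
     (\<forall>e\<in>E. w 0 e = w0 e) \<and>
     (\<forall>j. \<forall>e\<in>E. w (Suc j) e = w j e
        + s * (- \<kappa> (w j) e + (\<Sum>\<tau>\<in>E. \<kappa> (w j) \<tau> * edge_dist V E (w j) \<tau>) / (\<Sum>\<tau>\<in>E. w j \<tau>))
            * edge_dist V E (w j) e)"

lemma on_edge_eq:
  assumes "f x y = f y x"
  shows "on_edge f {x, y} = f x y"
  unfolding on_edge_def
  by (rule the_equality) (use assms in \<open>auto simp: doubleton_eq_iff\<close>)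

lemma path_edges_rev: "path_edges (rev xs) = rev (path_edges xs)"
proof (induction xs rule: induct_list012)
  case (3 a b xs)
  have app: "path_edges (ys @ [c, d]) = path_edges (ys @ [c]) @ [{c, d}]" for ys and c d :: 'a
    by (induction ys rule: induct_list012) (auto simp: path_edges_def)
  have "path_edges (rev (a # b # xs)) = path_edges (rev (b # xs)) @ [{b, a}]"
    by (simp add: app)
  also have "\<dots> = rev (path_edges (b # xs)) @ [{a, b}]"
    by (simp only: 3 insert_commute)
  also have "\<dots> = rev (path_edges (a # b # xs))"
    by (simp add: path_edges_def)
  finally show ?case .
qed (simp_all add: path_edges_def)

lemma graph_path_rev: "graph_path V E x y xs \<Longrightarrow> graph_path V E y x (rev xs)"
  by (auto simp: graph_path_def path_edges_rev hd_rev last_rev)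

lemma graph_dist_commute: "graph_dist V E w x y = graph_dist V E w y x"
proof -
  have "{xs. graph_path V E x y xs} = rev ` {xs. graph_path V E y x xs}"
  proof (intro equalityI subsetI)
    fix xs assume "xs \<in> {xs. graph_path V E x y xs}"
    then have "rev xs \<in> {xs. graph_path V E y x xs}" by (simp add: graph_path_rev)
    then show "xs \<in> rev ` {xs. graph_path V E y x xs}" by (rule rev_image_eqI) simp
  qed (auto simp: graph_path_rev)
  then show ?thesis
    by (simp add: graph_dist_def image_image path_edges_rev rev_map[symmetric] sum_list_rev)
qed

lemma wasserstein_commute:
  assumes "\<And>u v. d u v = d v u"
  shows "wasserstein V d \<mu>1 \<mu>2 = wasserstein V d \<mu>2 \<mu>1"
proof -
  have tr: "coupling V \<mu> \<nu> A \<Longrightarrow> coupling V \<nu> \<mu> (\<lambda>u v. A v u)" for \<mu> \<nu> A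
    by (auto simp: coupling_def)
  have eq: "{A. coupling V \<mu>1 \<mu>2 A} = (\<lambda>A u v. A v u) ` {A. coupling V \<mu>2 \<mu>1 A}"
  proof (intro equalityI subsetI)
    fix A assume "A \<in> {A. coupling V \<mu>1 \<mu>2 A}"
    then have "(\<lambda>u v. A v u) \<in> {A. coupling V \<mu>2 \<mu>1 A}" by (simp add: tr)
    then show "A \<in> (\<lambda>A u v. A v u) ` {A. coupling V \<mu>2 \<mu>1 A}" by (rule rev_image_eqI) simp
  qed (auto intro: tr)
  have cost: "(\<Sum>u\<in>V. \<Sum>v\<in>V. A v u * d u v) = (\<Sum>u\<in>V. \<Sum>v\<in>V. A u v * d u v)" for A
    by (subst sum.swap) (simp add: assms)
  show ?thesis
    unfolding wasserstein_def eq image_image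
    by (intro arg_cong[where f = Inf] image_cong refl cost)
qed

lemma edge_dist_eq: "edge_dist V E w {x, y} = graph_dist V E w x y"
  unfolding edge_dist_def by (rule on_edge_eq) (rule graph_dist_commute)

lemma ollivier_curvature_eq:
  "ollivier_curvature V E \<alpha> w {x, y} =
     1 - wasserstein V (graph_dist V E w) (lazy_walk V E w \<alpha> x) (lazy_walk V E w \<alpha> y)
         / graph_dist V E w x y"
  unfolding ollivier_curvature_def edge_dist_eq
  by (subst on_edge_eq) (auto intro: wasserstein_commute graph_dist_commute)

end

theory Submission
  imports Defs
begin

text \<open>Write \<open>S = (\<Sum>\<tau>\<in>E. w \<tau>)\<close>. Every distance is at most \<open>S\<close>, hence so is every transport cost, and
  therefore \<open>\<rho>\<^sub>e - S \<le> \<kappa>\<^sub>e \<rho>\<^sub>e\<close>, while \<open>\<kappa>\<^sub>e \<le> c\<close> with \<open>c = 1\<close> for Ollivier's curvature. These two bounds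
  alone show that one step of the flow multiplies each weight by at least \<open>1 - (m + c) s\<close> and \<open>S\<close>
  by at most \<open>1 + m s\<close>.

  Mixing a coupling at idleness \<open>\<alpha>\<close> with the point mass at \<open>(x, y)\<close> gives
  \<open>W\<^sub>\<beta> \<le> (1 - t) W\<^sub>\<alpha> + t \<rho>\<close> for \<open>\<beta> = (1 - t) \<alpha> + t\<close>, so \<open>\<kappa>\<^sup>\<alpha> / (1 - \<alpha>)\<close> is nondecreasing in \<open>\<alpha>\<close>. A coupling
  must send mass at least \<open>2 \<alpha> - 1\<close> from \<open>x\<close> to \<open>y\<close>, so this quotient is at most \<open>2\<close>. Hence the
  Lin--Lu--Yau curvature exists, is at most \<open>c = 2\<close> and is at least \<open>\<kappa>\<^sup>0\<close>, which returns the lower bound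
  for \<open>\<kappa>\<^sub>e \<rho>\<^sub>e\<close>.\<close>

section \<open>Edges of a path\<close>

lemma set_path_edges_subset: "e \<in> set (path_edges xs) \<Longrightarrow> e \<subseteq> set xs"
  by (cases xs) (auto simp: path_edges_def dest: set_zip_leftD set_zip_rightD)

lemma path_edges_Cons_Cons: "path_edges (a # b # xs) = {a, b} # path_edges (b # xs)"
  by (simp add: path_edges_def)

text \<open>The first vertex does not recur, so the first edge does not recur either. Path lengths
  thus become sums over sets of edges, comparable with the sum over \<open>E\<close>.\<close>

lemma distinct_path_edges: "distinct xs \<Longrightarrow> distinct (path_edges xs)"
proof (induction xs rule: induct_list012)
  case (3 a b xs)
  then show ?case
    using set_path_edges_subset[of "{a, b}" "b # xs"] by (auto simp: path_edges_Cons_Cons)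
qed (simp_all add: path_edges_def)

section \<open>Couplings of finite measures\<close>

lemma coupling_le_left:
  assumes "finite V" "coupling V \<mu> \<nu> A" "u \<in> V" "v \<in> V"
  shows "A u v \<le> \<mu> u"
  using assms member_le_sum[of v V "A u"] by (auto simp: coupling_def)

lemma coupling_sum:
  assumes "coupling V \<mu> \<nu> A"
  shows "(\<Sum>u\<in>V. \<Sum>v\<in>V. A u v) = sum \<mu> V"
  using assms by (auto simp: coupling_def)

text \<open>The independent coupling ensures that the infimum in \<open>wasserstein\<close> ranges
  over a nonempty set.\<close>

lemma coupling_product:
  assumes "finite V" "\<And>z. z \<in> V \<Longrightarrow> 0 \<le> \<mu> z" "\<And>z. z \<in> V \<Longrightarrow> 0 \<le> \<nu> z"
    and "sum \<mu> V = 1" "sum \<nu> V = 1"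
  shows "coupling V \<mu> \<nu> (\<lambda>u v. \<mu> u * \<nu> v)"
proof -
  have "\<mu> z \<le> 1" "\<nu> z \<le> 1" if "z \<in> V" for z
    using member_le_sum[of z V \<mu>] member_le_sum[of z V \<nu>] assms that by auto
  then show ?thesis
    using assms
    by (auto simp: coupling_def mult_le_one simp flip: sum_distrib_left sum_distrib_right)
qed

text \<open>Marginals depend linearly on the coupling, and the interval from 0 to 1 is
  convex.\<close>

lemma coupling_mix:
  assumes "coupling V \<mu> \<nu> A" "coupling V \<mu>' \<nu>' B" "0 \<le> t" "t \<le> 1"
  shows "coupling V (\<lambda>z. (1 - t) * \<mu> z + t * \<mu>' z) (\<lambda>z. (1 - t) * \<nu> z + t * \<nu>' z)
           (\<lambda>u v. (1 - t) * A u v + t * B u v)"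
proof -
  have "(1 - t) * a + t * b \<le> 1" if "a \<le> 1" "b \<le> 1" for a b :: real
    using convex_bound_le[of a 1 b "1 - t" t] that assms by simp
  then show ?thesis
    using assms by (auto simp: coupling_def sum.distrib simp flip: sum_distrib_left)
qed

lemma coupling_point_mass:
  assumes "finite V" "x \<in> V" "y \<in> V"
  shows "coupling V (\<lambda>z. of_bool (z = x)) (\<lambda>z. of_bool (z = y)) (\<lambda>u v. of_bool (u = x) * of_bool (v = y))"
  by (rule coupling_product) (use assms in \<open>auto simp: of_bool_def sum.delta\<close>)

text \<open>The mass that \<open>A\<close> moves from \<open>x\<close> to \<open>y\<close> is at least \<open>\<mu> x + \<nu> y - 1\<close>, by inclusion--exclusion.\<close>

lemma coupling_entry_ge:
  assumes "finite V" "coupling V \<mu> \<nu> A" "x \<in> V" "y \<in> V" "sum \<mu> V = 1"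
  shows "\<mu> x + \<nu> y - 1 \<le> A x y"
proof -
  have "1 = \<mu> x + sum \<mu> (V - {x})"
    using assms by (simp add: sum.remove[of V x])
  moreover have "sum (\<lambda>u. A u y) (V - {x}) \<le> sum \<mu> (V - {x})"
    by (rule sum_mono) (use assms coupling_le_left in auto)
  moreover have "\<nu> y = A x y + sum (\<lambda>u. A u y) (V - {x})"
    using assms sum.remove[of V x "\<lambda>u. A u y"] by (simp add: coupling_def)
  ultimately show ?thesis by simp
qed

section \<open>Bounds on the Wasserstein distance\<close>

lemma wasserstein_ge_0:
  assumes "coupling V \<mu> \<nu> A" "\<And>u v. u \<in> V \<Longrightarrow> v \<in> V \<Longrightarrow> 0 \<le> d u v"
  shows "0 \<le> wasserstein V d \<mu> \<nu>"
  unfolding wasserstein_def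
  by (rule cINF_greatest) (use assms in \<open>auto simp: coupling_def intro!: sum_nonneg mult_nonneg_nonneg\<close>)

lemma wasserstein_le_cost:
  assumes "coupling V \<mu> \<nu> A" "\<And>u v. u \<in> V \<Longrightarrow> v \<in> V \<Longrightarrow> 0 \<le> d u v"
  shows "wasserstein V d \<mu> \<nu> \<le> (\<Sum>u\<in>V. \<Sum>v\<in>V. A u v * d u v)"
  unfolding wasserstein_def
proof (rule cINF_lower)
  show "bdd_below ((\<lambda>A. \<Sum>u\<in>V. \<Sum>v\<in>V. A u v * d u v) ` {A. coupling V \<mu> \<nu> A})"
    by (rule bdd_belowI2[of _ 0])
      (use assms in \<open>auto simp: coupling_def intro!: sum_nonneg mult_nonneg_nonneg\<close>)
qed (use assms in auto)

text \<open>A coupling has total mass 1, so its cost is an average of values of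
  \<open>d\<close>.\<close>

lemma wasserstein_le_diameter:
  assumes "coupling V \<mu> \<nu> A" "sum \<mu> V = 1"
    and "\<And>u v. u \<in> V \<Longrightarrow> v \<in> V \<Longrightarrow> 0 \<le> d u v" "\<And>u v. u \<in> V \<Longrightarrow> v \<in> V \<Longrightarrow> d u v \<le> D"
  shows "wasserstein V d \<mu> \<nu> \<le> D"
proof -
  have "wasserstein V d \<mu> \<nu> \<le> (\<Sum>u\<in>V. \<Sum>v\<in>V. A u v * d u v)"
    using assms by (intro wasserstein_le_cost)
  also have "\<dots> \<le> (\<Sum>u\<in>V. \<Sum>v\<in>V. A u v * D)"
    by (intro sum_mono mult_left_mono) (use assms in \<open>auto simp: coupling_def\<close>)
  also have "\<dots> = (\<Sum>u\<in>V. \<Sum>v\<in>V. A u v) * D"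
    by (simp add: sum_distrib_right)
  also have "\<dots> = D"
    using coupling_sum[OF assms(1)] assms(2) by simp
  finally show ?thesis .
qed

text \<open>Every coupling pays for the mass that is forced to go from \<open>x\<close> to
  \<open>y\<close>, and the rest of its cost is nonnegative. The coupling \<open>A\<close>
  guarantees that the infimum is over a nonempty set.\<close>

lemma wasserstein_ge_entry:
  assumes "finite V" "coupling V \<mu> \<nu> A" "sum \<mu> V = 1" "x \<in> V" "y \<in> V"
    and "\<And>u v. u \<in> V \<Longrightarrow> v \<in> V \<Longrightarrow> 0 \<le> d u v"
  shows "(\<mu> x + \<nu> y - 1) * d x y \<le> wasserstein V d \<mu> \<nu>"
  unfolding wasserstein_def
proof (rule cINF_greatest)
  show "{A. coupling V \<mu> \<nu> A} \<noteq> {}" using assms by auto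
next
  fix B assume "B \<in> {A. coupling V \<mu> \<nu> A}"
  then have B: "coupling V \<mu> \<nu> B" by simp
  then have nn: "0 \<le> B u v * d u v" if "u \<in> V" "v \<in> V" for u v
    using assms that by (auto simp: coupling_def)
  have "(\<mu> x + \<nu> y - 1) * d x y \<le> B x y * d x y"
    using coupling_entry_ge[OF assms(1) B] assms by (intro mult_right_mono) auto
  also have "\<dots> \<le> (\<Sum>v\<in>V. B x v * d x v)"
    by (rule member_le_sum) (use nn assms in auto)
  also have "\<dots> \<le> (\<Sum>u\<in>V. \<Sum>v\<in>V. B u v * d u v)"
    by (rule member_le_sum[of x V "\<lambda>u. \<Sum>v\<in>V. B u v * d u v"]) (use nn assms in \<open>auto intro: sum_nonneg\<close>)
  finally show "(\<mu> x + \<nu> y - 1) * d x y \<le> (\<Sum>u\<in>V. \<Sum>v\<in>V. B u v * d u v)" .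
qed

lemma wasserstein_mix_point_mass:
  assumes "finite V" "coupling V \<mu> \<nu> A" "x \<in> V" "y \<in> V" "0 \<le> t" "t < 1"
    and nn: "\<And>u v. u \<in> V \<Longrightarrow> v \<in> V \<Longrightarrow> 0 \<le> d u v"
  shows "wasserstein V d (\<lambda>z. (1 - t) * \<mu> z + t * of_bool (z = x)) (\<lambda>z. (1 - t) * \<nu> z + t * of_bool (z = y))
           \<le> (1 - t) * wasserstein V d \<mu> \<nu> + t * d x y"
    (is "?W \<le> _")
proof -
  \<comment> \<open>Solving for the distance between \<open>\<mu>\<close> and \<open>\<nu>\<close>
    turns the claim into a lower bound for an infimum, checked on each coupling \<open>B\<close>
    without assuming an optimal one.\<close>
  have "(?W - t * d x y) / (1 - t) \<le> wasserstein V d \<mu> \<nu>"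
    unfolding wasserstein_def[of V d \<mu> \<nu>]
  proof (rule cINF_greatest)
    show "{A. coupling V \<mu> \<nu> A} \<noteq> {}" using assms by auto
  next
    fix B assume "B \<in> {A. coupling V \<mu> \<nu> A}"
    then have B: "coupling V \<mu> \<nu> B" by simp
    have "?W \<le> (\<Sum>u\<in>V. \<Sum>v\<in>V. ((1 - t) * B u v + t * (of_bool (u = x) * of_bool (v = y))) * d u v)"
      by (intro wasserstein_le_cost coupling_mix coupling_point_mass) (use assms B in auto)
    also have "\<dots> = (1 - t) * (\<Sum>u\<in>V. \<Sum>v\<in>V. B u v * d u v)
        + t * (\<Sum>u\<in>V. of_bool (u = x) * (\<Sum>v\<in>V. of_bool (v = y) * d u v))"
      by (simp add: distrib_right sum.distrib sum_distrib_left mult.assoc)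
    also have "(\<Sum>u\<in>V. of_bool (u = x) * (\<Sum>v\<in>V. of_bool (v = y) * d u v)) = d x y"
      using assms by (simp add: of_bool_def if_distrib[of "\<lambda>c. c * _"] cong: if_cong)
    finally show "(?W - t * d x y) / (1 - t) \<le> (\<Sum>u\<in>V. \<Sum>v\<in>V. B u v * d u v)"
      using assms by (simp add: divide_le_eq algebra_simps)
  qed
  then show ?thesis
    using assms by (simp add: divide_le_eq algebra_simps)
qed

section \<open>Distances in a positively weighted graph\<close>

lemma simple_graph_edgeE:
  assumes "simple_graph V E" "e \<in> E"
  obtains x y where "x \<in> V" "y \<in> V" "x \<noteq> y" "e = {x, y}"
  using assms unfolding simple_graph_def by blast

lemma simple_graph_edgeD:
  assumes "simple_graph V E" "{x, y} \<in> E"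
  shows "x \<in> V" "y \<in> V" "x \<noteq> y"
  using simple_graph_edgeE[OF assms] by (auto simp: doubleton_eq_iff)

lemma finite_edges: "simple_graph V E \<Longrightarrow> finite E"
  by (rule finite_subset[of _ "Pow V"]) (auto simp: simple_graph_def)

text \<open>Positivity is all that is required of the weights, so everything proved here applies to
  each vector \<open>w j\<close> of a solution.\<close>

locale weighted_graph =
  fixes V :: "'a set" and E :: "'a set set" and w :: "'a set \<Rightarrow> real"
  assumes conn: "connected_graph V E" and w_pos: "\<And>e. e \<in> E \<Longrightarrow> 0 < w e"
begin

lemma graph: "simple_graph V E"
  using conn by (simp add: connected_graph_def)

lemma finV: "finite V"
  using graph by (simp add: simple_graph_def)

lemmas finE = finite_edges[OF graph]
  and edgeE = simple_graph_edgeE[OF graph]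
  and edgeD = simple_graph_edgeD[OF graph]

lemma path_length_eq:
  assumes "graph_path V E x y xs"
  shows "sum_list (map w (path_edges xs)) = sum w (set (path_edges xs))"
  using assms by (simp add: graph_path_def distinct_path_edges sum_list_distinct_conv_sum_set)

lemma path_length_nonneg:
  assumes "graph_path V E x y xs"
  shows "0 \<le> sum_list (map w (path_edges xs))"
  unfolding path_length_eq[OF assms]
  using assms w_pos by (intro sum_nonneg) (auto simp: graph_path_def less_imp_le)

lemma graph_dist_le_path:
  assumes "graph_path V E x y xs"
  shows "graph_dist V E w x y \<le> sum_list (map w (path_edges xs))"
  unfolding graph_dist_def
  by (rule cINF_lower) (use assms path_length_nonneg in \<open>auto intro!: bdd_belowI2[of _ 0]\<close>)

lemma graph_dist_greatest:
  assumes "x \<in> V" "y \<in> V" "\<And>xs. graph_path V E x y xs \<Longrightarrow> c \<le> sum_list (map w (path_edges xs))"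
  shows "c \<le> graph_dist V E w x y"
  unfolding graph_dist_def
  by (rule cINF_greatest) (use assms conn in \<open>auto simp: connected_graph_def\<close>)

lemma graph_dist_nonneg: "x \<in> V \<Longrightarrow> y \<in> V \<Longrightarrow> 0 \<le> graph_dist V E w x y"
  by (rule graph_dist_greatest) (auto intro: path_length_nonneg)

text \<open>A path uses each edge at most once, so its length is at most the total weight.\<close>

lemma graph_dist_le_total:
  assumes "x \<in> V" "y \<in> V"
  shows "graph_dist V E w x y \<le> sum w E"
proof -
  obtain xs where xs: "graph_path V E x y xs"
    using assms conn by (auto simp: connected_graph_def)
  have "graph_dist V E w x y \<le> sum w (set (path_edges xs))"
    using graph_dist_le_path[OF xs] by (simp add: path_length_eq[OF xs])
  also have "\<dots> \<le> sum w E"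
    by (rule sum_mono2) (use xs finE w_pos in \<open>auto simp: graph_path_def less_imp_le\<close>)
  finally show ?thesis .
qed

lemma graph_dist_le_weight:
  assumes "{x, y} \<in> E"
  shows "graph_dist V E w x y \<le> w {x, y}"
  using graph_dist_le_path[of x y "[x, y]"] edgeD[OF assms] assms
  by (simp add: graph_path_def path_edges_def)

text \<open>Since \<open>x\<close> and \<open>y\<close> differ, every path between them has a first
  edge. The least weight is therefore a positive lower bound for all path lengths, and it survives
  the infimum.\<close>

lemma graph_dist_pos:
  assumes "{x, y} \<in> E"
  shows "0 < graph_dist V E w x y"
proof -
  note xy = edgeD[OF assms]
  have "Min (w ` E) \<le> graph_dist V E w x y"
  proof (rule graph_dist_greatest)
    fix xs assume p: "graph_path V E x y xs"
    then obtain b ys where xs: "xs = x # b # ys"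
      using xy by (cases xs; cases "tl xs")
        (auto simp: graph_path_def)
    have e: "{x, b} \<in> set (path_edges xs)"
      by (simp add: xs path_edges_Cons_Cons)
    then have "Min (w ` E) \<le> w {x, b}"
      using p finE by (intro Min_le) (auto simp: graph_path_def)
    also have "\<dots> \<le> sum w (set (path_edges xs))"
      by (rule member_le_sum) (use e p w_pos in \<open>auto simp: graph_path_def less_imp_le subset_iff\<close>)
    finally show "Min (w ` E) \<le> sum_list (map w (path_edges xs))"
      by (simp add: path_length_eq[OF p])
  qed (use xy in auto)
  moreover have "0 < Min (w ` E)"
    using assms finE w_pos by (subst Min_gr_iff) auto
  ultimately show ?thesis by simp
qed

lemma edge_dist_bounds:
  assumes "e \<in> E"
  shows "0 < edge_dist V E w e" "edge_dist V E w e \<le> w e"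
proof -
  obtain x y where "e = {x, y}"
    using edgeE[OF assms] by metis
  then show "0 < edge_dist V E w e" "edge_dist V E w e \<le> w e"
    using assms graph_dist_pos[of x y] graph_dist_le_weight[of x y] by (simp_all add: edge_dist_eq)
qed

section \<open>Lazy walks and the transport cost between them\<close>

lemma lazy_walk_nonneg: "0 \<le> \<alpha> \<Longrightarrow> \<alpha> \<le> 1 \<Longrightarrow> 0 \<le> lazy_walk V E w \<alpha> x z"
  using w_pos by (auto simp: lazy_walk_def less_imp_le intro!: divide_nonneg_nonneg sum_nonneg)

text \<open>The edge keeps \<open>x\<close> from being isolated, so the normalising sum is positive
  and the neighbours of \<open>x\<close> share exactly the mass \<open>1 - \<alpha>\<close>.\<close>

lemma sum_lazy_walk:
  assumes "{x, y} \<in> E"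
  shows "sum (lazy_walk V E w \<alpha> x) V = 1"
proof -
  note xy = edgeD[OF assms]
  let ?N = "{u \<in> V. {x, u} \<in> E}" and ?D = "\<Sum>u \<in> {u \<in> V. {x, u} \<in> E}. w {x, u}"
  have x_notin: "x \<notin> ?N" using edgeD(3)[of x x] by auto
  have D: "0 < ?D"
    by (rule sum_pos) (use finV xy assms w_pos in auto)
  have "sum (lazy_walk V E w \<alpha> x) V = \<alpha> + sum (lazy_walk V E w \<alpha> x) (V - {x})"
    using xy finV by (simp add: sum.remove[of V x] lazy_walk_def)
  also have "sum (lazy_walk V E w \<alpha> x) (V - {x}) = sum (lazy_walk V E w \<alpha> x) ?N"
    by (rule sum.mono_neutral_right) (use finV x_notin in \<open>auto simp: lazy_walk_def\<close>)
  also have "\<dots> = (\<Sum>u\<in>?N. (1 - \<alpha>) * w {x, u} / ?D)"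
    by (rule sum.cong) (use x_notin in \<open>auto simp: lazy_walk_def\<close>)
  also have "\<dots> = (1 - \<alpha>) * ?D / ?D"
    by (simp add: sum_divide_distrib sum_distrib_left)
  finally show ?thesis using D by simp
qed

lemma lazy_walk_coupling:
  assumes "{x, y} \<in> E" "0 \<le> \<alpha>" "\<alpha> \<le> 1"
  obtains A where "coupling V (lazy_walk V E w \<alpha> x) (lazy_walk V E w \<alpha> y) A"
  using that[OF coupling_product] finV lazy_walk_nonneg assms
    sum_lazy_walk[of x y \<alpha>] sum_lazy_walk[of y x \<alpha>] by (auto simp: insert_commute)

text \<open>Mixing with the point mass at \<open>x\<close> scales the moving part
  \<open>1 - \<alpha>\<close> by \<open>1 - t\<close>. Raising the idleness is thus the operation
  treated in \<open>wasserstein_mix_point_mass\<close>.\<close>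

lemma lazy_walk_mix:
  "lazy_walk V E w ((1 - t) * \<alpha> + t) x = (\<lambda>z. (1 - t) * lazy_walk V E w \<alpha> x z + t * of_bool (z = x))"
proof
  fix z
  have "1 - ((1 - t) * \<alpha> + t) = (1 - t) * (1 - \<alpha>)" by (simp add: algebra_simps)
  then show "lazy_walk V E w ((1 - t) * \<alpha> + t) x z = (1 - t) * lazy_walk V E w \<alpha> x z + t * of_bool (z = x)"
    by (simp add: lazy_walk_def)
qed

definition transport :: "real \<Rightarrow> 'a \<Rightarrow> 'a \<Rightarrow> real" where
  "transport \<alpha> x y = wasserstein V (graph_dist V E w) (lazy_walk V E w \<alpha> x) (lazy_walk V E w \<alpha> y)"

lemma transport_bounds:
  assumes "{x, y} \<in> E" "0 \<le> \<alpha>" "\<alpha> \<le> 1"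
  shows "0 \<le> transport \<alpha> x y" "transport \<alpha> x y \<le> sum w E"
    and "(2 * \<alpha> - 1) * graph_dist V E w x y \<le> transport \<alpha> x y"
proof -
  obtain A where A: "coupling V (lazy_walk V E w \<alpha> x) (lazy_walk V E w \<alpha> y) A"
    using lazy_walk_coupling[OF assms] .
  note xy = edgeD[OF assms(1)]
  show "0 \<le> transport \<alpha> x y"
    unfolding transport_def by (rule wasserstein_ge_0[OF A]) (rule graph_dist_nonneg)
  show "transport \<alpha> x y \<le> sum w E"
    unfolding transport_def
    by (rule wasserstein_le_diameter[OF A])
      (auto intro: graph_dist_nonneg graph_dist_le_total sum_lazy_walk[OF assms(1)])
  \<comment> \<open>Each walk keeps mass \<open>\<alpha>\<close> at its own starting point, so the
    forced mass is \<open>\<alpha> + \<alpha> - 1\<close>.\<close>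
  show "(2 * \<alpha> - 1) * graph_dist V E w x y \<le> transport \<alpha> x y"
    using wasserstein_ge_entry[OF finV A sum_lazy_walk[OF assms(1)] xy(1,2), of "graph_dist V E w"]
    by (simp add: graph_dist_nonneg transport_def lazy_walk_def)
qed

lemma transport_mix:
  assumes "{x, y} \<in> E" "0 \<le> \<alpha>" "\<alpha> \<le> 1" "0 \<le> t" "t < 1"
  shows "transport ((1 - t) * \<alpha> + t) x y \<le> (1 - t) * transport \<alpha> x y + t * graph_dist V E w x y"
proof -
  obtain A where A: "coupling V (lazy_walk V E w \<alpha> x) (lazy_walk V E w \<alpha> y) A"
    using lazy_walk_coupling[OF assms(1-3)] .
  show ?thesis
    unfolding transport_def lazy_walk_mix
    by (rule wasserstein_mix_point_mass[OF finV A])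
      (use assms edgeD[OF assms(1)] graph_dist_nonneg in auto)
qed

section \<open>Bounds on the two curvatures\<close>

lemma ollivier_eq:
  "ollivier_curvature V E \<alpha> w {x, y} = 1 - transport \<alpha> x y / graph_dist V E w x y"
  by (simp add: ollivier_curvature_eq transport_def)

text \<open>With \<open>\<kappa> \<rho> = \<rho> - W\<close>, these are the three estimates of
  \<open>transport_bounds\<close> in turn: \<open>W\<close> is nonnegative, at least
  \<open>(2 * \<alpha> - 1) \<rho>\<close>, and at most the total weight. The second bound vanishes
  at \<open>\<alpha> = 1\<close> and so survives division by \<open>1 - \<alpha>\<close>.\<close>

lemma ollivier_bounds:
  assumes "e \<in> E" "0 \<le> \<alpha>" "\<alpha> \<le> 1"
  shows "ollivier_curvature V E \<alpha> w e \<le> 1"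
    and "ollivier_curvature V E \<alpha> w e \<le> 2 * (1 - \<alpha>)"
    and "edge_dist V E w e - sum w E \<le> ollivier_curvature V E \<alpha> w e * edge_dist V E w e"
proof -
  obtain x y where e: "e = {x, y}" and xy: "{x, y} \<in> E"
    using edgeE[OF assms(1)] assms(1) by metis
  note d = graph_dist_pos[OF xy] and T = transport_bounds[OF xy assms(2,3)]
  show "ollivier_curvature V E \<alpha> w e \<le> 1"
    using d T by (simp add: e ollivier_eq)
  show "ollivier_curvature V E \<alpha> w e \<le> 2 * (1 - \<alpha>)"
    using d T(3) by (simp add: e ollivier_eq field_simps)
  show "edge_dist V E w e - sum w E \<le> ollivier_curvature V E \<alpha> w e * edge_dist V E w e"
    using d T(2) by (simp add: e ollivier_eq edge_dist_eq field_simps)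
qed

lemma ollivier_quotient_mono:
  assumes "e \<in> E" "0 \<le> \<alpha>" "\<alpha> \<le> \<beta>" "\<beta> < 1"
  shows "ollivier_curvature V E \<alpha> w e / (1 - \<alpha>) \<le> ollivier_curvature V E \<beta> w e / (1 - \<beta>)"
proof -
  obtain x y where e: "e = {x, y}" and xy: "{x, y} \<in> E"
    using edgeE[OF assms(1)] assms(1) by metis
  note d = graph_dist_pos[OF xy]
  \<comment> \<open>This \<open>t\<close> solves \<open>(1 - t) * \<alpha> + t = \<beta>\<close>.
    The mixing inequality then reads
    \<open>(1 - t) \<kappa>(\<alpha>) \<le> \<kappa>(\<beta>)\<close>, and \<open>1 - t\<close> is
    the ratio of the two denominators.\<close>
  define t where "t = (\<beta> - \<alpha>) / (1 - \<alpha>)"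
  have t: "1 - t = (1 - \<beta>) / (1 - \<alpha>)"
    using assms by (simp add: t_def field_simps)
  have "(1 - t) * \<alpha> + t = 1 - (1 - t) * (1 - \<alpha>)"
    by (simp add: algebra_simps)
  then have beta: "(1 - t) * \<alpha> + t = \<beta>"
    using assms by (simp add: t)
  have "0 \<le> t" "t < 1"
    using assms by (auto simp: t_def)
  then have "transport \<beta> x y \<le> (1 - t) * transport \<alpha> x y + t * graph_dist V E w x y"
    using transport_mix[OF xy, of \<alpha> t] assms by (simp add: beta)
  then have "transport \<beta> x y / graph_dist V E w x y
      \<le> ((1 - t) * transport \<alpha> x y + t * graph_dist V E w x y) / graph_dist V E w x y"
    using d by (simp add: divide_right_mono)
  also have "\<dots> = (1 - t) * (transport \<alpha> x y / graph_dist V E w x y) + t"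
    using d by (simp add: add_divide_distrib)
  finally have "(1 - t) * ollivier_curvature V E \<alpha> w e \<le> ollivier_curvature V E \<beta> w e"
    by (simp add: e ollivier_eq algebra_simps)
  then show ?thesis
    using assms by (simp add: t field_simps)
qed

text \<open>\<open>Lim\<close> says nothing about the quotient until convergence is known. A
  nondecreasing function that is bounded above converges from the left to its supremum.\<close>

lemma lin_lu_yau_limit:
  assumes "e \<in> E"
  shows "((\<lambda>\<alpha>. ollivier_curvature V E \<alpha> w e / (1 - \<alpha>)) \<longlongrightarrow> lin_lu_yau_curvature V E w e) (at_left 1)"
proof -
  define h where "h \<alpha> = ollivier_curvature V E \<alpha> w e / (1 - \<alpha>)" for \<alpha>
  \<comment> \<open>The supremum is over idleness in \<open>{0..<1}\<close>, the range where both
    the bound and the monotonicity have been proved.\<close>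
  define L where "L = (SUP \<alpha>\<in>{0..<1}. h \<alpha>)"
  have h_le: "h \<alpha> \<le> 2" if "\<alpha> \<in> {0..<1}" for \<alpha>
    using ollivier_bounds(2)[OF assms, of \<alpha>] that by (simp add: h_def divide_le_eq)
  then have bdd: "bdd_above (h ` {0..<1})"
    by (rule bdd_aboveI2)
  have near: "eventually (\<lambda>\<alpha>. \<alpha> \<in> {a<..<1}) (at_left (1::real))" if "a < 1" for a
    using that by (rule eventually_at_leftI[rotated]) auto
  have "(h \<longlongrightarrow> L) (at_left 1)"
  proof (rule increasing_tendsto)
    show "eventually (\<lambda>\<alpha>. h \<alpha> \<le> L) (at_left 1)"
      using near[OF zero_less_one] by eventually_elim (auto simp: L_def intro!: cSUP_upper bdd)
  next
    fix c assume "c < L"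
    then obtain a where a: "a \<in> {0..<1}" "c < h a"
      unfolding L_def using bdd by (subst (asm) less_cSUP_iff) auto
    have "eventually (\<lambda>\<alpha>. \<alpha> \<in> {a<..<1}) (at_left 1)"
      using a near by auto
    then show "eventually (\<lambda>\<alpha>. c < h \<alpha>) (at_left 1)"
    proof eventually_elim
      case (elim \<alpha>)
      then have "h a \<le> h \<alpha>"
        unfolding h_def using a by (intro ollivier_quotient_mono[OF assms]) auto
      with a show ?case by simp
    qed
  qed
  moreover from this have "lin_lu_yau_curvature V E w e = L"
    unfolding lin_lu_yau_curvature_def h_def by (intro tendsto_Lim) auto
  ultimately show ?thesis
    by (simp add: h_def[abs_def])
qed

lemma lin_lu_yau_bounds:
  assumes "e \<in> E"
  shows "lin_lu_yau_curvature V E w e \<le> 2"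
    and "edge_dist V E w e - sum w E \<le> lin_lu_yau_curvature V E w e * edge_dist V E w e"
proof -
  have near: "eventually (\<lambda>\<alpha>. \<alpha> \<in> {0<..<1}) (at_left (1::real))"
    by (rule eventually_at_leftI[of 0 1]) auto
  show "lin_lu_yau_curvature V E w e \<le> 2"
  proof (rule tendsto_upperbound[OF lin_lu_yau_limit[OF assms]])
    show "eventually (\<lambda>\<alpha>. ollivier_curvature V E \<alpha> w e / (1 - \<alpha>) \<le> 2) (at_left 1)"
      using near
    proof eventually_elim
      case (elim \<alpha>)
      then show ?case using ollivier_bounds(2)[OF assms, of \<alpha>] by (simp add: divide_le_eq)
    qed
  qed simp
  \<comment> \<open>At idleness 0 the denominator is 1, so the quotient is the curvature itself and
    monotonicity puts it below the limit.\<close>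
  have "ollivier_curvature V E 0 w e \<le> lin_lu_yau_curvature V E w e"
  proof (rule tendsto_lowerbound[OF lin_lu_yau_limit[OF assms]])
    show "eventually (\<lambda>\<alpha>. ollivier_curvature V E 0 w e \<le> ollivier_curvature V E \<alpha> w e / (1 - \<alpha>)) (at_left 1)"
      using near
    proof eventually_elim
      case (elim \<alpha>)
      then show ?case using ollivier_quotient_mono[OF assms, of 0 \<alpha>] by simp
    qed
  qed simp
  then have "ollivier_curvature V E 0 w e * edge_dist V E w e
      \<le> lin_lu_yau_curvature V E w e * edge_dist V E w e"
    using edge_dist_bounds(1)[OF assms] by (simp add: mult_right_mono)
  then show "edge_dist V E w e - sum w E \<le> lin_lu_yau_curvature V E w e * edge_dist V E w e"
    using ollivier_bounds(3)[OF assms, of 0] by simp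
qed

end

section \<open>The flow: a single step, then its iteration\<close>

definition flow_step ::
  "'a set \<Rightarrow> 'a set set \<Rightarrow> (('a set \<Rightarrow> real) \<Rightarrow> 'a set \<Rightarrow> real) \<Rightarrow> real \<Rightarrow> ('a set \<Rightarrow> real) \<Rightarrow> 'a set \<Rightarrow> real" where
  "flow_step V E \<kappa> s w e = w e
     + s * (- \<kappa> w e + (\<Sum>\<tau>\<in>E. \<kappa> w \<tau> * edge_dist V E w \<tau>) / (\<Sum>\<tau>\<in>E. w \<tau>)) * edge_dist V E w e"

text \<open>The hypotheses \<open>upper\<close> and \<open>lower\<close> isolate what both
  curvatures satisfy, so one argument with parameter \<open>c\<close> serves for both.\<close>

lemma (in weighted_graph) flow_step_bounds:
  assumes "E \<noteq> {}" "0 \<le> s"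
    and upper: "\<And>e. e \<in> E \<Longrightarrow> \<kappa> w e \<le> c"
    and lower: "\<And>e. e \<in> E \<Longrightarrow> edge_dist V E w e - sum w E \<le> \<kappa> w e * edge_dist V E w e"
    and "0 \<le> c"
  shows "e \<in> E \<Longrightarrow> (1 - (real (card E) + c) * s) * w e \<le> flow_step V E \<kappa> s w e"
    and "(\<Sum>e\<in>E. flow_step V E \<kappa> s w e) \<le> (1 + real (card E) * s) * sum w E"
proof -
  define S where "S = sum w E"
  define R where "R = (\<Sum>e\<in>E. edge_dist V E w e)"
  define K where "K = (\<Sum>e\<in>E. \<kappa> w e * edge_dist V E w e)"
  note \<rho> = edge_dist_bounds
  have S: "0 < S"
    unfolding S_def using assms finE w_pos by (intro sum_pos) auto
  have R: "0 \<le> R" "R \<le> S"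
    unfolding R_def S_def using \<rho> by (auto intro!: sum_nonneg sum_mono simp: less_imp_le)
  have "R - real (card E) * S \<le> K"
    \<comment> \<open>Summing \<open>lower\<close> over the edges produces the factor
      \<open>card E\<close>; the nonnegative term \<open>R\<close> is then dropped.\<close>
    using sum_mono[OF lower, of E] by (simp add: R_def K_def S_def sum_subtractf)
  then have K: "- K \<le> real (card E) * S"
    using R by simp
  have step: "flow_step V E \<kappa> s w e
      = w e + s * (- (\<kappa> w e * edge_dist V E w e) + K / S * edge_dist V E w e)" for e
    by (simp add: flow_step_def K_def S_def algebra_simps)
  show "(1 - (real (card E) + c) * s) * w e \<le> flow_step V E \<kappa> s w e" if e: "e \<in> E"
  proof -
    have "- real (card E) \<le> K / S"
      using K S by (simp add: field_simps)
    then have "(- c - real (card E)) * edge_dist V E w e \<le> (- \<kappa> w e + K / S) * edge_dist V E w e"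
      using upper[OF e] \<rho>[OF e] by (intro mult_right_mono) auto
    \<comment> \<open>Replacing the distance by the larger weight makes the possible loss
      proportional to \<open>w e\<close> itself, as a multiplicative bound requires.\<close>
    moreover have "(c + real (card E)) * edge_dist V E w e \<le> (c + real (card E)) * w e"
      using \<rho>[OF e] \<open>0 \<le> c\<close> by (intro mult_left_mono) auto
    ultimately have "- (real (card E) + c) * w e \<le> - (\<kappa> w e * edge_dist V E w e) + K / S * edge_dist V E w e"
      by (simp add: algebra_simps)
    from mult_left_mono[OF this \<open>0 \<le> s\<close>] show ?thesis
      by (simp add: step algebra_simps)
  qed
  have "(\<Sum>e\<in>E. flow_step V E \<kappa> s w e) = S + s * (- K + K / S * R)"
    by (simp only: step sum.distrib sum_negf S_def K_def R_def flip: sum_distrib_left)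
  moreover have "- K + K / S * R \<le> real (card E) * S"
  proof -
    \<comment> \<open>Distances do not exceed weights, so \<open>R / S\<close> lies between 0 and 1.
      The normalising term therefore only damps the growth caused by \<open>- K\<close>.\<close>
    have "- K + K / S * R = - K * (1 - R / S)"
      by (simp add: algebra_simps)
    also have "\<dots> \<le> real (card E) * S * (1 - R / S)"
      using K R S by (intro mult_right_mono) (auto simp: field_simps)
    also have "\<dots> \<le> real (card E) * S"
      using R S by (intro mult_left_le) (auto simp: field_simps)
    finally show ?thesis .
  qed
  from mult_left_mono[OF this \<open>0 \<le> s\<close>]
  have "s * (- K + K / S * R) \<le> real (card E) * s * S"
    by (simp only: mult_ac)
  ultimately show "(\<Sum>e\<in>E. flow_step V E \<kappa> s w e) \<le> (1 + real (card E) * s) * sum w E"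
    by (simp add: S_def distrib_right)
qed

text \<open>The recursion is explicit, so existence reduces to positivity of the iterates, which
  holds because each step multiplies a weight by at least \<open>1 - (card E + c) * s > 0\<close>.
  The curvature bounds are assumed for all positive weights, since the iterates are not known
  beforehand.\<close>

lemma flow_global_solution:
  fixes V :: "'a set"
  assumes conn: "connected_graph V E" and "E \<noteq> {}" and w0: "\<forall>e\<in>E. 0 < w0 e"
    and s: "0 < s" "(real (card E) + c) * s < 1" and "0 \<le> c"
    and upper: "\<And>w e. weighted_graph V E w \<Longrightarrow> e \<in> E \<Longrightarrow> \<kappa> w e \<le> c"
    and lower: "\<And>w e. weighted_graph V E w \<Longrightarrow> e \<in> E
        \<Longrightarrow> edge_dist V E w e - sum w E \<le> \<kappa> w e * edge_dist V E w e"
  shows "\<exists>!w. global_solution V E \<kappa> s w0 w"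
    and "\<And>w j e. global_solution V E \<kappa> s w0 w \<Longrightarrow> e \<in> E \<Longrightarrow>
        (1 - (real (card E) + c) * s) ^ j * w0 e \<le> w j e \<and>
        w j e \<le> (1 + real (card E) * s) ^ j * sum w0 E"
proof -
  have wg: "weighted_graph V E u" if "u \<in> E \<rightarrow>\<^sub>E {0<..}" for u
    using that conn by (auto simp: weighted_graph_def)
  have finE: "finite E"
    using conn finite_edges unfolding connected_graph_def by blast
  have step_bounds: "e \<in> E \<Longrightarrow> (1 - (real (card E) + c) * s) * u e \<le> flow_step V E \<kappa> s u e"
    "(\<Sum>e\<in>E. flow_step V E \<kappa> s u e) \<le> (1 + real (card E) * s) * sum u E"
    if "u \<in> E \<rightarrow>\<^sub>E {0<..}" for u e
    using weighted_graph.flow_step_bounds[OF wg[OF that] \<open>E \<noteq> {}\<close>, of s \<kappa> c]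
      upper[OF wg[OF that]] lower[OF wg[OF that]] s(1) \<open>0 \<le> c\<close> by simp_all
  \<comment> \<open>Fixing the values off \<open>E\<close> by \<open>restrict\<close> makes a
    solution literally an iteration of one map, so uniqueness is an induction on
    \<open>j\<close>.\<close>
  have sol_iff: "global_solution V E \<kappa> s w0 w \<longleftrightarrow> (\<forall>j. w j \<in> E \<rightarrow>\<^sub>E {0<..}) \<and> w 0 = restrict w0 E
      \<and> (\<forall>j. w (Suc j) = restrict (flow_step V E \<kappa> s (w j)) E)" for w
    unfolding global_solution_def flow_step_def[symmetric]
    by (metis (no_types, lifting) PiE_restrict restrict_apply' restrict_ext)
  show "\<exists>!w. global_solution V E \<kappa> s w0 w"
  proof (rule ex_ex1I)
    define w where "w = rec_nat (restrict w0 E) (\<lambda>_ u. restrict (flow_step V E \<kappa> s u) E)"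
    have "w j \<in> E \<rightarrow>\<^sub>E {0<..}" for j
    proof (induction j)
      case 0
      then show ?case using w0 by (auto simp: w_def)
    next
      case (Suc j)
      have "0 < flow_step V E \<kappa> s (w j) e" if "e \<in> E" for e
      proof -
        have "0 < (1 - (real (card E) + c) * s) * w j e"
          using s Suc that by (auto simp: PiE_iff)
        also have "\<dots> \<le> flow_step V E \<kappa> s (w j) e"
          using step_bounds(1) Suc that by blast
        finally show ?thesis .
      qed
      then show ?case by (auto simp: w_def)
    qed
    then have "global_solution V E \<kappa> s w0 w"
      unfolding sol_iff by (simp add: w_def)
    then show "\<exists>w. global_solution V E \<kappa> s w0 w" by blast
  next
    fix w w' assume "global_solution V E \<kappa> s w0 w" "global_solution V E \<kappa> s w0 w'"
    then have "w j = w' j" for j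
      by (induction j) (auto simp: sol_iff)
    then show "w = w'" ..
  qed
  fix w j e assume sol: "global_solution V E \<kappa> s w0 w" and e: "e \<in> E"
  then have w: "w j \<in> E \<rightarrow>\<^sub>E {0<..}" "w 0 = restrict w0 E"
    "w (Suc j) = restrict (flow_step V E \<kappa> s (w j)) E" for j
    by (auto simp: sol_iff)
  have "(1 - (real (card E) + c) * s) ^ j * w0 e \<le> w j e"
  proof (induction j)
    case 0
    then show ?case using e by (simp add: w(2))
  next
    case (Suc j)
    then have "(1 - (real (card E) + c) * s) * ((1 - (real (card E) + c) * s) ^ j * w0 e)
        \<le> (1 - (real (card E) + c) * s) * w j e"
      using s by (intro mult_left_mono) auto
    also have "\<dots> \<le> w (Suc j) e"
      using step_bounds(1)[OF w(1)] e by (simp add: w(3))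
    finally show ?case by (simp add: mult.assoc)
  qed
  \<comment> \<open>The growth estimate closes up only for the total weight. A single weight is then
    bounded by the total, whence the initial sum on the right.\<close>
  moreover have "sum (w j) E \<le> (1 + real (card E) * s) ^ j * sum w0 E"
  proof (induction j)
    case 0
    then show ?case by (simp add: w(2))
  next
    case (Suc j)
    have "sum (w (Suc j)) E \<le> (1 + real (card E) * s) * sum (w j) E"
      using step_bounds(2)[OF w(1)] by (simp add: w(3))
    also have "\<dots> \<le> (1 + real (card E) * s) * ((1 + real (card E) * s) ^ j * sum w0 E)"
      using s Suc by (intro mult_left_mono) auto
    finally show ?case by (simp add: mult.assoc)
  qed
  moreover have "w j e \<le> sum (w j) E"
    by (rule member_le_sum) (use e finE w(1)[of j] in \<open>auto simp: PiE_iff less_imp_le\<close>)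
  ultimately show "(1 - (real (card E) + c) * s) ^ j * w0 e \<le> w j e \<and>
      w j e \<le> (1 + real (card E) * s) ^ j * sum w0 E"
    by simp
qed

section \<open>Specialisation to the two curvatures\<close>

theorem theorem2p2:
  fixes V :: "'a set" and E :: "'a set set" and m :: nat and w0 :: "'a set \<Rightarrow> real"
  assumes "connected_graph V E" and "E \<noteq> {}" and "m = card E"
    and "\<forall>e\<in>E. 0 < w0 e"
  shows
    "(\<forall>\<alpha>\<in>{0..1}. \<forall>s. 0 < s \<and> s < 1 / (real m + 1) \<longrightarrow>
        (\<exists>!w. global_solution V E (ollivier_curvature V E \<alpha>) s w0 w) \<and>
        (\<forall>w. global_solution V E (ollivier_curvature V E \<alpha>) s w0 w \<longrightarrow>
           (\<forall>j. \<forall>e\<in>E. (1 - (real m + 1) * s) ^ j * w0 e \<le> w j e \<and>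
                        w j e \<le> (1 + real m * s) ^ j * (\<Sum>\<tau>\<in>E. w0 \<tau>))))
     \<and>
     (\<forall>s. 0 < s \<and> s < 1 / (2 * real m + 2) \<longrightarrow>
        (\<exists>!w. global_solution V E (lin_lu_yau_curvature V E) s w0 w) \<and>
        (\<forall>w. global_solution V E (lin_lu_yau_curvature V E) s w0 w \<longrightarrow>
           (\<forall>j. \<forall>e\<in>E. (1 - 2 * (real m + 1) * s) ^ j * w0 e \<le> w j e \<and>
                        w j e \<le> (1 + 2 * (real m + 1) * s) ^ j * (\<Sum>\<tau>\<in>E. w0 \<tau>))))"
proof (intro conjI ballI allI impI; (elim conjE)?)
  fix \<alpha> s :: real assume \<alpha>: "\<alpha> \<in> {0..1}" and s: "0 < s" "s < 1 / (real m + 1)"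
  have "(real (card E) + 1) * s < 1"
    using s assms(3) by (simp add: field_simps)
  note sol = flow_global_solution[OF assms(1,2,4) s(1) this, where \<kappa> = "ollivier_curvature V E \<alpha>"]
  have ub: "ollivier_curvature V E \<alpha> w e \<le> 1" if "weighted_graph V E w" "e \<in> E" for w e
    using weighted_graph.ollivier_bounds(1)[OF that] \<alpha> by simp
  have lb: "edge_dist V E w e - sum w E \<le> ollivier_curvature V E \<alpha> w e * edge_dist V E w e"
    if "weighted_graph V E w" "e \<in> E" for w e
    using weighted_graph.ollivier_bounds(3)[OF that] \<alpha> by simp
  show "\<exists>!w. global_solution V E (ollivier_curvature V E \<alpha>) s w0 w"
    by (rule sol(1)[OF _ ub lb]) auto
  fix w j e assume w: "global_solution V E (ollivier_curvature V E \<alpha>) s w0 w" and e: "e \<in> E"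
  show "(1 - (real m + 1) * s) ^ j * w0 e \<le> w j e" "w j e \<le> (1 + real m * s) ^ j * (\<Sum>\<tau>\<in>E. w0 \<tau>)"
    using sol(2)[OF _ ub lb w e, of j] assms(3) by auto
next
  fix s :: real assume s: "0 < s" "s < 1 / (2 * real m + 2)"
  have m: "2 * (real m + 1) * s < 1"
    using s by (simp add: field_simps)
  \<comment> \<open>The general result with \<open>c = 2\<close> involves \<open>m + 2\<close>, and
    growth rate \<open>m\<close>; both are at most \<open>2 * (m + 1)\<close>, so the stated bounds
    follow by weakening.\<close>
  have le: "(real m + 2) * s \<le> 2 * (real m + 1) * s"
    using s by (intro mult_right_mono) auto
  have "(real (card E) + 2) * s < 1"
    using m le assms(3) by simp
  note sol = flow_global_solution[OF assms(1,2,4) s(1) this, where \<kappa> = "lin_lu_yau_curvature V E",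
      OF _ weighted_graph.lin_lu_yau_bounds]
  show "\<exists>!w. global_solution V E (lin_lu_yau_curvature V E) s w0 w"
    by (rule sol(1)) auto
  fix w j e assume w: "global_solution V E (lin_lu_yau_curvature V E) s w0 w" and e: "e \<in> E"
  have bounds: "(1 - (real m + 2) * s) ^ j * w0 e \<le> w j e" "w j e \<le> (1 + real m * s) ^ j * sum w0 E"
    using sol(2)[OF _ _ _ _ _ w e, of j] assms(3) by auto
  \<comment> \<open>Monotonicity of powers needs a nonnegative smaller base, which the assumed range
    of \<open>s\<close> supplies.\<close>
  have "(1 - 2 * (real m + 1) * s) ^ j * w0 e \<le> (1 - (real m + 2) * s) ^ j * w0 e"
    using m le assms(4) e by (intro mult_right_mono power_mono) (auto simp: less_imp_le)
  then show "(1 - 2 * (real m + 1) * s) ^ j * w0 e \<le> w j e"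
    using bounds(1) by simp
  have "(1 + real m * s) ^ j * sum w0 E \<le> (1 + 2 * (real m + 1) * s) ^ j * sum w0 E"
    using s assms(4) by (intro mult_right_mono power_mono add_left_mono sum_nonneg) (auto simp: less_imp_le)
  then show "w j e \<le> (1 + 2 * (real m + 1) * s) ^ j * (\<Sum>\<tau>\<in>E. w0 \<tau>)"
    using bounds(2) by simp
qed

end
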